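(* Let $X$ be a sequentially complete locally convex space and let $\mathcal{P}$ be a calibration on $X$. If $T\in Q_{\mathcal{P}}(X)$, then $|\sigma(Q_{\mathcal{P}},T)|=r_{\mathcal{P}}(T)$.
   Context: All locally convex spaces are Hausdorff over $\mathbb{C}$ and all operators are linear. A calibration on a locally convex space $X$ is a family $\mathcal{P}$ of seminorms generating the topology of $X$, i.e. the sets $\{x\in X: p(x)<\varepsilon\}$ ($p\in\mathcal{P}$, $\varepsilon>0$) form a neighborhood sub-base at $0$. An operator $T:X\to X$ is quotient bounded with respect to $\mathcal{P}$ if for every $p\in\mathcal{P}$ there is $c_p>0$ with $p(Tx)\le c_p\,p(x)$ for all $x\in X$; $Q_{\mathcal{P}}(X)$ denotes the algebra of all such operators. For $p\in\mathcal{P}$ and $T\in Q_{\mathcal{P}}(X)$ put $\hat p(T)=\inf\{r>0: p(Tx)\le r\,p(x)\ \forall x\in X\}$; $Q_{\mathcal{P}}(X)$ carries the topology generated by the seminorms $\hat p$, $p\in\mathcal{P}$. The $\mathcal{P}$-spectral radius of $T$ is $r_{\mathcal{P}}(T)=\inf\{\alpha>0: \text{the set } \{(\alpha^{-1}T)^n\}_{n\ge1}\text{ is bounded in }Q_{\mathcal{P}}(X)\}\in[0,\infty]$ (with $\inf\emptyset=\infty$). The resolvent set $\rho(Q_{\mathcal{P}},T)$ is the set of $\lambda\in\mathbb{C}$ such that $\lambda I-T$ is invertible with $(\lambda I-T)^{-1}\in Q_{\mathcal{P}}(X)$, and $\sigma(Q_{\mathcal{P}},T)=\mathbb{C}\setminus\rho(Q_{\mathcal{P}},T)$.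 For a set $\sigma\subset\mathbb{C}$, $|\sigma|=\sup\{|\lambda|:\lambda\in\sigma\}\in[0,\infty]$. *)

theory Defs
  imports "HOL-Analysis.Analysis"
begin

text \<open>
  The scalar field is the field of complex numbers, so the scalar multiplication
  is an explicit parameter \<open>scaleC\<close>; addition, topology and the Hausdorff property
  come from the type classes of the ground type.
\<close>

locale locally_convex_space = vector_space scaleC
  for scaleC :: "complex \<Rightarrow> 'a \<Rightarrow> 'a::{topological_ab_group_add, t2_space}" +
  assumes continuous_scale: "continuous_on UNIV (\<lambda>(c, x). scaleC c x)"
    and convex_nhds_base:
      "\<And>U. open U \<Longrightarrow> 0 \<in> U \<Longrightarrow>
         \<exists>C. open C \<and> 0 \<in> C \<and> C \<subseteq> U \<and>
             (\<forall>x\<in>C. \<forall>y\<in>C. \<forall>t\<in>{0..1::real}.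
                scaleC (of_real (1 - t)) x + scaleC (of_real t) y \<in> C)"

text \<open>
  The library's \<open>Cauchy\<close> needs the type class \<open>uniform_space\<close>; here the uniformity is
  the one induced by the topological group structure.
\<close>

definition Cauchy_seq :: "(nat \<Rightarrow> 'a::topological_ab_group_add) \<Rightarrow> bool" where
  "Cauchy_seq s \<longleftrightarrow>
     (\<forall>U. open U \<and> 0 \<in> U \<longrightarrow> (\<exists>N. \<forall>m\<ge>N. \<forall>n\<ge>N. s m - s n \<in> U))"

definition sequentially_complete :: "'a::topological_ab_group_add itself \<Rightarrow> bool" where
  "sequentially_complete _ \<longleftrightarrow> (\<forall>s::nat \<Rightarrow> 'a. Cauchy_seq s \<longrightarrow> convergent s)"

definition seminorm :: "(complex \<Rightarrow> 'a \<Rightarrow> 'a::ab_group_add) \<Rightarrow> ('a \<Rightarrow> real) \<Rightarrow> bool" where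
  "seminorm scaleC p \<longleftrightarrow>
     (\<forall>x y. p (x + y) \<le> p x + p y) \<and> (\<forall>c x. p (scaleC c x) = cmod c * p x)"

definition calibration ::
  "(complex \<Rightarrow> 'a \<Rightarrow> 'a::topological_ab_group_add) \<Rightarrow> ('a \<Rightarrow> real) set \<Rightarrow> bool" where
  "calibration scaleC P \<longleftrightarrow>
     (\<forall>p\<in>P. seminorm scaleC p) \<and>
     (let B = {{x. p x < e} | p e. p \<in> P \<and> e > 0} in
        (\<forall>V\<in>B. \<exists>U. open U \<and> 0 \<in> U \<and> U \<subseteq> V) \<and>
        (\<forall>U. open U \<and> 0 \<in> U \<longrightarrow> (\<exists>F. finite F \<and> F \<subseteq> B \<and> \<Inter>F \<subseteq> U)))"

definition quotient_bounded ::
  "(complex \<Rightarrow> 'a \<Rightarrow> 'a::ab_group_add) \<Rightarrow> ('a \<Rightarrow> real) set \<Rightarrow> ('a \<Rightarrow> 'a) set" where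
  "quotient_bounded scaleC P =
     {T. Vector_Spaces.linear scaleC scaleC T \<and> (\<forall>p\<in>P. \<exists>c>0. \<forall>x. p (T x) \<le> c * p x)}"

definition op_seminorm :: "('a \<Rightarrow> real) \<Rightarrow> ('a \<Rightarrow> 'a) \<Rightarrow> real" where
  "op_seminorm p T = Inf {r. r > 0 \<and> (\<forall>x. p (T x) \<le> r * p x)}"

text \<open>
  The whole algebra is added to the sub-base so that it is the underlying set also for \<open>P = {}\<close>.
\<close>

definition qb_topology ::
  "(complex \<Rightarrow> 'a \<Rightarrow> 'a::ab_group_add) \<Rightarrow> ('a \<Rightarrow> real) set \<Rightarrow> ('a \<Rightarrow> 'a) topology" where
  "qb_topology scaleC P =
     topology_generated_by
       (insert (quotient_bounded scaleC P)
          {{S \<in> quotient_bounded scaleC P. op_seminorm p (\<lambda>x. S x - R x) < e} | p R e.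
             p \<in> P \<and> R \<in> quotient_bounded scaleC P \<and> e > 0})"

text \<open>Boundedness in the topological vector space sense: absorbed by every neighbourhood of zero.\<close>

definition qb_bounded ::
  "(complex \<Rightarrow> 'a \<Rightarrow> 'a::ab_group_add) \<Rightarrow> ('a \<Rightarrow> real) set \<Rightarrow> ('a \<Rightarrow> 'a) set \<Rightarrow> bool" where
  "qb_bounded scaleC P A \<longleftrightarrow>
     A \<subseteq> quotient_bounded scaleC P \<and>
     (\<forall>U. openin (qb_topology scaleC P) U \<and> (\<lambda>x. 0) \<in> U \<longrightarrow>
        (\<exists>s>0. \<forall>c. cmod c \<ge> s \<longrightarrow> A \<subseteq> (\<lambda>S x. scaleC c (S x)) ` U))"

text \<open>
  Values in \<open>[0,\<infinity>]\<close> are taken in \<open>ennreal\<close>, where the infimum of the empty set is \<open>\<infinity>\<close>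
  and the supremum of the empty set is \<open>0\<close>.
\<close>

definition spectral_radius_P ::
  "(complex \<Rightarrow> 'a \<Rightarrow> 'a::ab_group_add) \<Rightarrow> ('a \<Rightarrow> real) set \<Rightarrow> ('a \<Rightarrow> 'a) \<Rightarrow> ennreal" where
  "spectral_radius_P scaleC P T =
     (INF \<alpha> \<in> {\<alpha>::real. \<alpha> > 0 \<and>
          qb_bounded scaleC P {(\<lambda>x. scaleC (of_real (inverse \<alpha>)) (T x)) ^^ n | n. n \<ge> 1}}.
        ennreal \<alpha>)"

definition resolvent_set_P ::
  "(complex \<Rightarrow> 'a \<Rightarrow> 'a::ab_group_add) \<Rightarrow> ('a \<Rightarrow> real) set \<Rightarrow> ('a \<Rightarrow> 'a) \<Rightarrow> complex set" where
  "resolvent_set_P scaleC P T =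
     {z. bij (\<lambda>x. scaleC z x - T x) \<and> inv (\<lambda>x. scaleC z x - T x) \<in> quotient_bounded scaleC P}"

definition spectrum_P ::
  "(complex \<Rightarrow> 'a \<Rightarrow> 'a::ab_group_add) \<Rightarrow> ('a \<Rightarrow> real) set \<Rightarrow> ('a \<Rightarrow> 'a) \<Rightarrow> complex set" where
  "spectrum_P scaleC P T = - resolvent_set_P scaleC P T"

definition set_modulus :: "complex set \<Rightarrow> ennreal" where
  "set_modulus \<sigma> = (SUP z \<in> \<sigma>. ennreal (cmod z))"

end

(*
  Fix a calibrating seminorm p and put R z = (1 - z T)^(-1), for z in a closed disc of radius r all of
  whose nonzero points are reciprocals of points of the resolvent set. Neumann series give one
  inequality. For the other, the resolvent identity and compactness make R Lipschitz on the disc with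
  respect to p. The average of R over the N rotations of t by the N-th roots of unity is
  (1 - t^N T^N)^(-1), hence Lipschitz in t with a constant that does not depend on N. So if s^N T^N
  tends to 0 in p, then these averages stay close to the identity for t in [s, s + delta], which
  bounds t^N T^N; as delta does not depend on s, finitely many such steps reach every t < r. This
  replaces the Cauchy integral formula and needs neither completions nor the Hahn-Banach theorem.
*)
theory Submission
  imports Defs
begin

section \<open>Sums over roots of unity\<close>

lemma cis_root_of_unity: "N > 0 \<Longrightarrow> cis (2 * pi * real k / real N) ^ N = 1"
  by (simp only: Complex.DeMoivre) simp

text \<open>The sum is geometric with ratio \<open>w\<close>, the \<open>j\<close>-th power of a
  primitive \<open>N\<close>-th root of unity. Here \<open>w ^ N = 1\<close>, while
  \<open>w \<noteq> 1\<close> because \<open>N\<close> does not divide \<open>j\<close>.\<close>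

lemma sum_root_of_unity_powers:
  assumes "0 < j" "j < N"
  shows "(\<Sum>k<N. cis (2 * pi * real k / real N) ^ j) = 0"
proof -
  define w where "w = cis (2 * pi * real j / real N)"
  have N: "N > 0" using assms by auto
  have w_ne: "w \<noteq> 1"
  proof
    assume "w = 1"
    then have "exp (\<i> * complex_of_real (2 * pi * real j / real N)) = 1"
      by (simp only: w_def cis_conv_exp)
    then obtain n :: int where "2 * pi * real j / real N = of_int (2 * n) * pi"
      unfolding exp_eq_1 by auto
    then have "real j = of_int n * real N"
      using N by (simp add: field_simps)
    then have "int j = n * int N"
      by (metis of_int_eq_iff of_int_mult of_int_of_nat_eq)
    then have "int N dvd int j" by simp
    then show False using assms by (auto dest: dvd_imp_le)
  qed
  have w_N: "w ^ N = 1" using N by (simp only: w_def cis_root_of_unity)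
  have "(\<Sum>k<N. cis (2 * pi * real k / real N) ^ j) = (\<Sum>k<N. w ^ k)"
    by (intro sum.cong refl) (simp add: w_def Complex.DeMoivre mult_ac)
  also have "\<dots> = 0"
    using geometric_sum[OF w_ne, of N] w_N by simp
  finally show ?thesis .
qed

section \<open>Elementary facts about a single seminorm\<close>

locale seminormed_space = vector_space scale
  for scale :: "complex \<Rightarrow> 'a \<Rightarrow> 'a::ab_group_add" (infixr "\<odot>" 75) +
  fixes p :: "'a \<Rightarrow> real"
  assumes seminorm: "seminorm scale p"
begin

lemma p_add: "p (x + y) \<le> p x + p y"
  using seminorm by (simp add: seminorm_def)

lemma p_scale: "p (c \<odot> x) = cmod c * p x"
  using seminorm by (simp add: seminorm_def)

lemma p_zero: "p 0 = 0"
  using p_scale[of 0 0] by simp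

lemma p_minus: "p (- x) = p x"
  using p_scale[of "-1" x] by (simp add: scale_minus_left)

lemma p_nonneg: "0 \<le> p x"
  using p_add[of x "- x"] by (simp add: p_minus p_zero)

lemma p_diff: "p (x - y) \<le> p x + p y"
  using p_add[of x "- y"] by (simp add: p_minus)

lemma p_sum: "p (sum f A) \<le> (\<Sum>i\<in>A. p (f i))"
proof (induction A rule: infinite_finite_induct)
  case (insert i A)
  then show ?case using p_add[of "f i" "sum f A"] by simp
qed (simp_all add: p_zero)

lemma funpow_bound:
  assumes "\<And>x. p (T x) \<le> a * p x" "0 \<le> a"
  shows "p ((T ^^ n) x) \<le> a ^ n * p x"
proof (induction n)
  case (Suc n)
  have "p ((T ^^ Suc n) x) \<le> a * p ((T ^^ n) x)" using assms(1) by simp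
  also have "\<dots> \<le> a * (a ^ n * p x)" by (intro mult_left_mono Suc assms)
  finally show ?case by simp
qed simp

end

section \<open>The inverses of \<open>1 - z T\<close> on a closed disc\<close>

locale resolvent_on_disc = seminormed_space scale p
  for scale :: "complex \<Rightarrow> 'a \<Rightarrow> 'a::ab_group_add" (infixr "\<odot>" 75) and p +
  fixes T :: "'a \<Rightarrow> 'a" and R :: "complex \<Rightarrow> 'a \<Rightarrow> 'a" and r a :: real
  assumes linear_T: "Vector_Spaces.linear scale scale T"
    and T_bound: "p (T x) \<le> a * p x"
    and a_nonneg: "0 \<le> a"
    and linear_R: "cmod z \<le> r \<Longrightarrow> Vector_Spaces.linear scale scale (R z)"
    and R_left: "cmod z \<le> r \<Longrightarrow> R z (x - z \<odot> T x) = x"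
    and R_right: "cmod z \<le> r \<Longrightarrow> R z x - z \<odot> T (R z x) = x"
    and R_bound: "cmod z \<le> r \<Longrightarrow> \<exists>c. \<forall>x. p (R z x) \<le> c * p x"
begin

lemmas T_hom = linear_T[unfolded linear_iff_module_hom]
lemmas R_hom = linear_R[unfolded linear_iff_module_hom]

text \<open>With \<open>y = R z x\<close>, the vector \<open>x\<close> equals
  \<open>(1 - z T) y = (1 - w T) y - (z - w) T y\<close>; applying \<open>R w\<close> to this gives
  the claim.\<close>

lemma resolvent_identity:
  assumes "cmod z \<le> r" "cmod w \<le> r"
  shows "R z x - R w x = (z - w) \<odot> R w (T (R z x))"
proof -
  define y where "y = R z x"
  have "x = y - z \<odot> T y"
    using R_right[OF assms(1)] by (simp add: y_def)
  also have "\<dots> = (y - w \<odot> T y) - (z - w) \<odot> T y"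
    by (simp add: scale_left_diff_distrib)
  finally have "R w x = R w (y - w \<odot> T y) - (z - w) \<odot> R w (T y)"
    using R_hom[OF assms(2)] by (simp only: module_hom.diff module_hom.scale)
  then show ?thesis
    using R_left[OF assms(2), of y] by (simp add: y_def)
qed

text \<open>The resolvent identity bounds \<open>p (R z x)\<close> by a multiple of
  \<open>p x\<close> plus a multiple of \<open>p (R z x)\<close> itself. For \<open>z\<close> near
  \<open>w\<close> the second factor is at most 1/2, so that term is absorbed on the left. No series
  has to converge.\<close>

lemma R_locally_bounded:
  assumes "cmod w \<le> r"
  shows "\<exists>d>0. \<exists>c. \<forall>z x. cmod z \<le> r \<and> dist w z < d \<longrightarrow> p (R z x) \<le> c * p x"
proof -
  obtain c0 where c0: "\<And>x. p (R w x) \<le> c0 * p x" using R_bound[OF assms] by auto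
  \<comment> \<open>The given constant may be negative when \<open>p\<close> vanishes identically;
    the monotonicity arguments below need \<open>c \<ge> 0\<close>.\<close>
  define c where "c = max c0 0"
  have c: "p (R w x) \<le> c * p x" for x
    by (rule order_trans[OF c0]) (simp add: c_def mult_right_mono p_nonneg)
  have c_nonneg: "c \<ge> 0" by (simp add: c_def)
  \<comment> \<open>Chosen so that \<open>d * (c * a) \<le> 1/2\<close>; the summand 1 keeps the
    denominator positive if \<open>c * a = 0\<close>.\<close>
  define d where "d = 1 / (2 * (c * a + 1))"
  have ca: "0 \<le> c * a" using c_nonneg a_nonneg by simp
  then have d_pos: "d > 0" by (simp add: d_def)
  have "d * (c * a + 1) = 1/2"
    using ca by (simp add: d_def divide_simps)
  then have d_le: "d * (c * a) \<le> 1/2" using d_pos by (simp add: algebra_simps)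
  have "p (R z x) \<le> 2 * c * p x" if z: "cmod z \<le> r" "dist w z < d" for z x
  proof -
    have "p (R z x) = p (R w x + (z - w) \<odot> R w (T (R z x)))"
      by (simp add: resolvent_identity[OF z(1) assms, of x, symmetric])
    also have "\<dots> \<le> p (R w x) + cmod (z - w) * p (R w (T (R z x)))"
      using p_add p_scale by metis
    also have "\<dots> \<le> c * p x + d * (c * (a * p (R z x)))"
    proof (intro add_mono mult_mono c)
      show "cmod (z - w) \<le> d" using z(2) by (simp add: dist_norm norm_minus_commute)
      show "p (R w (T (R z x))) \<le> c * (a * p (R z x))"
        by (rule order_trans[OF c]) (intro mult_left_mono T_bound c_nonneg)
    qed (use d_pos p_nonneg in auto)
    also have "\<dots> \<le> c * p x + 1/2 * p (R z x)"
      using mult_right_mono[OF d_le p_nonneg[of "R z x"]] by (simp add: mult.assoc)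
    finally show ?thesis by simp
  qed
  with d_pos show ?thesis by blast
qed

text \<open>\<open>R_bound\<close> allows a different constant at each point. Compactness of the
  disc reduces the local bounds to finitely many.\<close>

lemma R_uniformly_bounded:
  "\<exists>M\<ge>0. \<forall>z x. cmod z \<le> r \<longrightarrow> p (R z x) \<le> M * p x"
proof -
  obtain d c where d: "\<And>w. cmod w \<le> r \<Longrightarrow> d w > 0"
    and c: "\<And>w z x. cmod w \<le> r \<Longrightarrow> cmod z \<le> r \<Longrightarrow> dist w z < d w \<Longrightarrow> p (R z x) \<le> c w * p x"
    using R_locally_bounded by metis
  obtain W where W: "W \<subseteq> cball (0::complex) r" "finite W" "cball 0 r \<subseteq> (\<Union>w\<in>W. ball w (d w))"
  proof (rule compactE_image[of "cball (0::complex) r" "cball (0::complex) r" "\<lambda>w. ball w (d w)"])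
    show "cball 0 r \<subseteq> (\<Union>w\<in>cball (0::complex) r. ball w (d w))"
      using d by fastforce
  qed auto
  \<comment> \<open>The sum dominates each local constant and is nonnegative even for empty
    \<open>W\<close>.\<close>
  define M where "M = (\<Sum>w\<in>W. \<bar>c w\<bar>)"
  have "p (R z x) \<le> M * p x" if z: "cmod z \<le> r" for z x
  proof -
    obtain w where w: "w \<in> W" "dist w z < d w" using W(3) z by (force simp: subset_iff)
    have "p (R z x) \<le> c w * p x" using c[of w z x] w z W(1) by auto
    also have "\<dots> \<le> M * p x"
    proof (rule mult_right_mono[OF _ p_nonneg])
      have "\<bar>c w\<bar> \<le> M" unfolding M_def using w W(2) by (intro member_le_sum) auto
      then show "c w \<le> M" by simp
    qed
    finally show ?thesis .
  qed
  moreover have "M \<ge> 0" by (simp add: M_def sum_nonneg)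
  ultimately show ?thesis by blast
qed

text \<open>The uniform bound is applied to both resolvents on the right of the resolvent
  identity.\<close>

lemma R_lipschitz:
  "\<exists>L>0. \<forall>z w x. cmod z \<le> r \<and> cmod w \<le> r \<longrightarrow> p (R z x - R w x) \<le> cmod (z - w) * L * p x"
proof -
  obtain M where M: "M \<ge> 0" "\<And>z x. cmod z \<le> r \<Longrightarrow> p (R z x) \<le> M * p x"
    using R_uniformly_bounded by auto
  \<comment> \<open>The summand 1 makes \<open>L\<close> positive, so that step lengths such as
    \<open>1 / (4 * L)\<close> make sense later.\<close>
  define L where "L = M * a * M + 1"
  have "p (R z x - R w x) \<le> cmod (z - w) * L * p x" if "cmod z \<le> r" "cmod w \<le> r" for z w x
  proof -
    have "p (R w (T (R z x))) \<le> M * (a * (M * p x))"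
      by (meson M a_nonneg mult_left_mono order_trans T_bound that)
    also have "\<dots> \<le> L * p x"
      using p_nonneg[of x] by (simp add: L_def algebra_simps)
    finally have "cmod (z - w) * p (R w (T (R z x))) \<le> cmod (z - w) * (L * p x)"
      by (intro mult_left_mono) auto
    then show ?thesis
      by (simp add: resolvent_identity[OF that] p_scale mult.assoc)
  qed
  moreover have "L > 0" using M(1) a_nonneg by (simp add: L_def add_nonneg_pos)
  ultimately show ?thesis by blast
qed

text \<open>This is the finite geometric sum: \<open>1 - z^N T^N\<close> is \<open>1 - z T\<close>
  times the sum of the \<open>z^j T^j\<close> with \<open>j < N\<close>, and \<open>R z\<close>
  cancels the first factor.\<close>

lemma R_power_left:
  assumes "cmod z \<le> r"
  shows "R z (x - z ^ N \<odot> (T ^^ N) x) = (\<Sum>j<N. z ^ j \<odot> (T ^^ j) x)"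
proof (induction N)
  case 0
  then show ?case using module_hom.zero[OF R_hom[OF assms]] by simp
next
  case (Suc N)
  define y where "y = z ^ N \<odot> (T ^^ N) x"
  have "z ^ Suc N \<odot> (T ^^ Suc N) x = z \<odot> T y"
    by (simp add: y_def module_hom.scale[OF T_hom])
  then have "R z (x - z ^ Suc N \<odot> (T ^^ Suc N) x) = R z ((x - y) + (y - z \<odot> T y))"
    by simp
  also have "\<dots> = R z (x - y) + y"
    using R_left[OF assms, of y] by (simp only: module_hom.add[OF R_hom[OF assms]])
  also have "\<dots> = (\<Sum>j<Suc N. z ^ j \<odot> (T ^^ j) x)"
    using Suc by (simp add: y_def)
  finally show ?case .
qed

section \<open>Averages of the resolvent over rotations by roots of unity\<close>

definition avg :: "nat \<Rightarrow> complex \<Rightarrow> 'a \<Rightarrow> 'a" where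
  "avg N t x = (1 / of_nat N) \<odot> (\<Sum>k<N. R (cis (2 * pi * real k / real N) * t) x)"

lemma cmod_rotated: "cmod t \<le> r \<Longrightarrow> cmod (cis \<phi> * t) \<le> r"
  by (simp add: norm_mult)

lemma avg_diff:
  assumes "cmod t \<le> r"
  shows "avg N t (x - y) = avg N t x - avg N t y"
  unfolding avg_def
  by (simp add: module_hom.diff[OF R_hom[OF cmod_rotated[OF assms]]] sum_subtractf
      scale_right_diff_distrib)

text \<open>Expanding each rotated resolvent as a finite geometric sum and exchanging the sums,
  orthogonality of the roots of unity removes every power of \<open>T\<close> except the zeroth.
  Thus \<open>avg N t\<close> is a left inverse of \<open>1 - t^N T^N\<close>.\<close>

lemma avg_left:
  assumes "N > 0" "cmod t \<le> r"
  shows "avg N t (x - t ^ N \<odot> (T ^^ N) x) = x"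
proof -
  define \<omega> where "\<omega> k = cis (2 * pi * real k / real N)" for k
  have \<omega>_N: "\<omega> k ^ N = 1" for k
    using assms(1) by (simp only: \<omega>_def cis_root_of_unity)
  have "(\<Sum>k<N. R (\<omega> k * t) (x - t ^ N \<odot> (T ^^ N) x))
      = (\<Sum>k<N. \<Sum>j<N. (\<omega> k * t) ^ j \<odot> (T ^^ j) x)"
  proof (rule sum.cong[OF refl])
    fix k
    \<comment> \<open>All \<open>N\<close> rotations of \<open>t\<close> have the same
      \<open>N\<close>-th power, so \<open>R_power_left\<close> applies to one and the same
      argument.\<close>
    have "t ^ N = (\<omega> k * t) ^ N" by (simp add: power_mult_distrib \<omega>_N)
    then show "R (\<omega> k * t) (x - t ^ N \<odot> (T ^^ N) x) = (\<Sum>j<N. (\<omega> k * t) ^ j \<odot> (T ^^ j) x)"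
      using R_power_left[of "\<omega> k * t"] cmod_rotated[OF assms(2)] by (simp add: \<omega>_def)
  qed
  also have "\<dots> = (\<Sum>j<N. \<Sum>k<N. (\<omega> k * t) ^ j \<odot> (T ^^ j) x)"
    by (rule sum.swap)
  also have "\<dots> = (\<Sum>j<N. (if j = 0 then of_nat N else 0) \<odot> x)"
  proof (rule sum.cong[OF refl])
    fix j assume "j \<in> {..<N}"
    then have "(\<Sum>k<N. \<omega> k ^ j) = (if j = 0 then of_nat N else 0)"
      using sum_root_of_unity_powers[of j N] by (simp add: \<omega>_def)
    moreover have "(\<Sum>k<N. (\<omega> k * t) ^ j \<odot> (T ^^ j) x)
        = ((\<Sum>k<N. \<omega> k ^ j) * t ^ j) \<odot> (T ^^ j) x"
      by (simp add: scale_sum_left power_mult_distrib sum_distrib_right)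
    ultimately show "(\<Sum>k<N. (\<omega> k * t) ^ j \<odot> (T ^^ j) x) = (if j = 0 then of_nat N else 0) \<odot> x"
      by auto
  qed
  also have "\<dots> = of_nat N \<odot> x"
    using assms(1) by (simp add: scale_sum_left[symmetric])
  finally show ?thesis
    using assms(1) by (simp add: avg_def \<omega>_def)
qed

text \<open>A bound common to all rotations survives averaging, so the constant does not grow with
  \<open>N\<close>.\<close>

lemma avg_bound:
  assumes "\<And>k x. p (R (cis (2 * pi * real k / real N) * s) x - R (cis (2 * pi * real k / real N) * t) x)
      \<le> c * p x" "N > 0"
  shows "p (avg N s x - avg N t x) \<le> c * p x"
proof -
  define \<omega> where "\<omega> k = cis (2 * pi * real k / real N)" for k
  have "p (\<Sum>k<N. R (\<omega> k * s) x - R (\<omega> k * t) x) \<le> (\<Sum>k<N. c * p x)"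
    by (rule order_trans[OF p_sum]) (intro sum_mono, simp add: \<omega>_def assms(1))
  then have "p (\<Sum>k<N. R (\<omega> k * s) x - R (\<omega> k * t) x) / real N \<le> c * p x"
    using assms(2) by (simp add: field_simps)
  moreover have "p (avg N s x - avg N t x) = p (\<Sum>k<N. R (\<omega> k * s) x - R (\<omega> k * t) x) / real N"
    unfolding avg_def \<omega>_def scale_right_diff_distrib[symmetric] sum_subtractf[symmetric]
    by (simp add: p_scale norm_divide)
  ultimately show ?thesis by simp
qed

lemma avg_uniformly_bounded:
  "\<exists>M>0. \<forall>N t x. N > 0 \<and> cmod t \<le> r \<longrightarrow> p (avg N t x) \<le> M * p x"
proof -
  obtain M where M: "M \<ge> 0" "\<And>z x. cmod z \<le> r \<Longrightarrow> p (R z x) \<le> M * p x"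
    using R_uniformly_bounded by auto
  \<comment> \<open>\<open>M + 1\<close> is strictly positive, which permits tolerances such as
    \<open>1 / (4 * M)\<close> below.\<close>
  have "p (avg N t x) \<le> (M + 1) * p x" if "N > 0" "cmod t \<le> r" for N t x
  proof -
    have "p (\<Sum>k<N. R (cis (2 * pi * real k / real N) * t) x) \<le> (\<Sum>k<N. M * p x)"
      by (rule order_trans[OF p_sum]) (intro sum_mono M cmod_rotated that)
    then have "p (avg N t x) \<le> M * p x"
      using that(1) by (simp add: avg_def p_scale norm_divide field_simps)
    then show ?thesis using p_nonneg[of x] by (simp add: algebra_simps)
  qed
  with M(1) show ?thesis by (intro exI[of _ "M + 1"]) auto
qed

section \<open>Decay of the scaled powers of \<open>T\<close>\<close>

definition powers_vanish :: "real \<Rightarrow> bool" where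
  "powers_vanish s \<longleftrightarrow> (\<forall>e>0. \<exists>N0. \<forall>N\<ge>N0. \<forall>x. s ^ N * p ((T ^^ N) x) \<le> e * p x)"

text \<open>Decay at \<open>s\<close> puts \<open>avg N s\<close> within 1/4 of the identity, and
  the Lipschitz bound adds at most 1/4 on the way to \<open>t\<close>. An operator within 1/2 of the
  identity that is a left inverse of \<open>1 - B\<close> forces \<open>p (B x) \<le> p x\<close>;
  here \<open>B\<close> is \<open>t^N T^N\<close>.\<close>

lemma powers_bounded_ahead:
  assumes L: "\<And>z w x. cmod z \<le> r \<Longrightarrow> cmod w \<le> r \<Longrightarrow> p (R z x - R w x) \<le> cmod (z - w) * L * p x"
    and s: "powers_vanish s" "0 \<le> s" "s \<le> t" "t \<le> r" "(t - s) * L \<le> 1/4"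
  shows "\<exists>N0. \<forall>N\<ge>N0. \<forall>x. t ^ N * p ((T ^^ N) x) \<le> p x"
proof -
  obtain M where M: "M > 0" "\<And>N t x. N > 0 \<Longrightarrow> cmod t \<le> r \<Longrightarrow> p (avg N t x) \<le> M * p x"
    using avg_uniformly_bounded by blast
  \<comment> \<open>Applying \<open>avg N s\<close> costs a factor \<open>M\<close>, so the
    tolerance \<open>1 / (4 * M)\<close> leaves 1/4.\<close>
  obtain N0 where N0: "\<And>N x. N \<ge> N0 \<Longrightarrow> s ^ N * p ((T ^^ N) x) \<le> 1 / (4 * M) * p x"
    using s(1) M(1) unfolding powers_vanish_def
    by (metis divide_pos_pos mult_pos_pos zero_less_numeral zero_less_one)
  have "t ^ N * p ((T ^^ N) x) \<le> p x" if N: "N \<ge> max N0 1" for N x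
  proof -
    have cs: "cmod (complex_of_real s) \<le> r" and ct: "cmod (complex_of_real t) \<le> r" and Np: "N > 0"
      using s N by auto
    have close_s: "p (avg N s y - y) \<le> 1/4 * p y" for y
    proof -
      have "avg N s y - y = avg N s y - avg N s (y - complex_of_real s ^ N \<odot> (T ^^ N) y)"
        by (simp only: avg_left[OF Np cs])
      also have "\<dots> = avg N s (complex_of_real s ^ N \<odot> (T ^^ N) y)"
        by (simp add: avg_diff[OF cs, symmetric])
      finally have "p (avg N s y - y) \<le> M * (s ^ N * p ((T ^^ N) y))"
        using M(2)[OF Np cs, of "complex_of_real s ^ N \<odot> (T ^^ N) y"] s(2)
        by (simp add: p_scale norm_power)
      also have "\<dots> \<le> M * (1 / (4 * M) * p y)"
        using N M(1) by (intro mult_left_mono N0) auto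
      finally show ?thesis using M(1) by simp
    qed
    have close_t: "p (avg N t y - y) \<le> 1/2 * p y" for y
    proof -
      have "p (avg N t y - avg N s y) \<le> 1/4 * p y"
      proof (rule avg_bound[OF _ Np])
        fix k y
        let ?\<omega> = "cis (2 * pi * real k / real N)"
        have "p (R (?\<omega> * t) y - R (?\<omega> * s) y) \<le> cmod (?\<omega> * t - ?\<omega> * s) * L * p y"
          by (intro L cmod_rotated cs ct)
        \<comment> \<open>The common rotation factors out, so the distance is \<open>t - s\<close>
          whatever \<open>k\<close> and \<open>N\<close> are.\<close>
        also have "?\<omega> * t - ?\<omega> * s = ?\<omega> * of_real (t - s)"
          by (simp add: right_diff_distrib)
        also have "cmod \<dots> = t - s" using s by (simp only: norm_mult norm_cis norm_of_real) simp
        finally show "p (R (?\<omega> * t) y - R (?\<omega> * s) y) \<le> 1/4 * p y"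
          using mult_right_mono[OF s(5) p_nonneg[of y]] by linarith
      qed
      moreover have "p (avg N t y - y) \<le> p (avg N t y - avg N s y) + p (avg N s y - y)"
        using p_add[of "avg N t y - avg N s y" "avg N s y - y"] by simp
      ultimately show ?thesis using close_s[of y] by simp
    qed
    define y where "y = complex_of_real t ^ N \<odot> (T ^^ N) x"
    have "avg N t y = avg N t x - x"
      using avg_left[OF Np ct, of x] by (simp add: y_def avg_diff[OF ct] algebra_simps)
    \<comment> \<open>\<open>y\<close> is \<open>avg N t x - x\<close> minus
      \<open>avg N t y - y\<close>. The second difference costs at most half of \<open>p y\<close>
      and is absorbed.\<close>
    then have "p y \<le> p (avg N t x - x) + p (avg N t y - y)"
      using p_diff[of "avg N t y" "avg N t y - y"] by simp
    then have "p y \<le> p x"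
      using close_t[of x] close_t[of y] by simp
    then show ?thesis
      using s by (simp add: y_def p_scale norm_power)
  qed
  then show ?thesis by blast
qed

text \<open>Boundedness at some \<open>u > t\<close> becomes decay at \<open>t\<close>, because the
  factor \<open>(t / u)^N\<close> tends to 0. This restores the hypothesis for the next
  step.\<close>

lemma powers_vanish_ahead:
  assumes L: "\<And>z w x. cmod z \<le> r \<Longrightarrow> cmod w \<le> r \<Longrightarrow> p (R z x - R w x) \<le> cmod (z - w) * L * p x"
    and "L > 0" "powers_vanish s" "0 \<le> s" "s \<le> t" "t < r" "(t - s) * L < 1/4"
  shows "powers_vanish t"
proof -
  \<comment> \<open>The farthest point that \<open>powers_bounded_ahead\<close> reaches from
    \<open>s\<close>. The strict inequalities in the hypotheses place \<open>t\<close> before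
    it.\<close>
  define u where "u = min r (s + 1 / (4 * L))"
  have u: "t < u" "u \<le> r" "(u - s) * L \<le> 1/4" "s \<le> u"
  proof -
    have "t < s + 1 / (4 * L)" using assms by (simp add: field_simps)
    then show "t < u" using assms by (simp add: u_def)
    then show "s \<le> u" using assms by simp
    have "(u - s) * L \<le> (1 / (4 * L)) * L"
      using assms(2) by (intro mult_right_mono) (auto simp: u_def)
    then show "(u - s) * L \<le> 1/4" using assms(2) by simp
  qed (simp add: u_def)
  obtain N1 where N1: "\<And>N x. N \<ge> N1 \<Longrightarrow> u ^ N * p ((T ^^ N) x) \<le> p x"
    using powers_bounded_ahead[OF L assms(3,4) u(4,2,3)] by auto
  have t0: "0 \<le> t" using assms by simp
  show ?thesis unfolding powers_vanish_def
  proof (intro allI impI)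
    fix e :: real assume e: "e > 0"
    have q: "0 \<le> t / u" "t / u < 1" using t0 u(1) by (auto simp: divide_simps)
    obtain N2 where N2: "(t / u) ^ N2 < e" using real_arch_pow_inv[OF e q(2)] by auto
    have "t ^ N * p ((T ^^ N) x) \<le> e * p x" if "N \<ge> max N1 N2" for N x
    proof -
      have "t ^ N * p ((T ^^ N) x) = (t / u) ^ N * (u ^ N * p ((T ^^ N) x))"
        using t0 u(1) by (simp add: power_divide)
      also have "\<dots> \<le> (t / u) ^ N * p x"
        using that q by (intro mult_left_mono N1) auto
      also have "\<dots> \<le> e * p x"
      proof (rule mult_right_mono[OF _ p_nonneg])
        have "(t / u) ^ N \<le> (t / u) ^ N2" using that q by (intro power_decreasing) auto
        then show "(t / u) ^ N \<le> e" using N2 by simp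
      qed
      finally show ?thesis .
    qed
    then show "\<exists>N0. \<forall>N\<ge>N0. \<forall>x. t ^ N * p ((T ^^ N) x) \<le> e * p x" by blast
  qed
qed

text \<open>The step length depends only on the Lipschitz constant, so finitely many equal steps
  lead from 0 to \<open>t\<close>.\<close>

lemma powers_vanish_below:
  assumes "0 \<le> t" "t < r"
  shows "powers_vanish t"
proof -
  obtain L where L: "L > 0"
    "\<And>z w x. cmod z \<le> r \<Longrightarrow> cmod w \<le> r \<Longrightarrow> p (R z x - R w x) \<le> cmod (z - w) * L * p x"
    using R_lipschitz by blast
  \<comment> \<open>Half of the admissible length \<open>1 / (4 * L)\<close>, which gives the strict
    inequality required.\<close>
  define d where "d = 1 / (8 * L)"
  have d: "d > 0" "d * L < 1/4" using L(1) by (auto simp: d_def)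
  have "powers_vanish (min t (real n * d))" for n
  proof (induction n)
    case 0
    \<comment> \<open>Decay at 0 starts with \<open>N = 1\<close>, since \<open>0 ^ 0\<close> is
      1.\<close>
    have "0 ^ N * p ((T ^^ N) x) \<le> e * p x" if "N \<ge> 1" "e > 0" for N e x
      using that p_nonneg[of x] by (simp add: power_0_left)
    then show ?case using assms unfolding powers_vanish_def by auto
  next
    case (Suc n)
    show ?case
    proof (rule powers_vanish_ahead[OF L(2,1) Suc])
      have "min t (real (Suc n) * d) - min t (real n * d) \<le> d"
        using d by (auto simp: min_def algebra_simps)
      from mult_right_mono[OF this, of L] d(2) L(1)
      show "(min t (real (Suc n) * d) - min t (real n * d)) * L < 1/4" by linarith
      show "min t (real n * d) \<le> min t (real (Suc n) * d)"
        using d by (intro min.mono) (auto simp: algebra_simps)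
    qed (use assms d in auto)
  qed
  moreover obtain n where "t < real n * d"
    using reals_Archimedean3[OF d(1)] by blast
  ultimately show ?thesis by (metis less_eq_real_def min.absorb1)
qed

lemma powers_bounded_below:
  assumes "0 \<le> t" "t < r"
  shows "\<exists>C>0. \<forall>n x. t ^ n * p ((T ^^ n) x) \<le> C * p x"
proof -
  obtain N0 where N0: "\<And>N x. N \<ge> N0 \<Longrightarrow> t ^ N * p ((T ^^ N) x) \<le> 1 * p x"
    using powers_vanish_below[OF assms] unfolding powers_vanish_def by (metis zero_less_one)
  \<comment> \<open>The 1 covers \<open>n \<ge> N0\<close>; the sum dominates each of the finitely
    many earlier terms, which are controlled by the bound \<open>a\<close> for
    \<open>T\<close>.\<close>
  define C where "C = 1 + (\<Sum>n<N0. (t * a) ^ n)"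
  have ta: "0 \<le> t * a" using assms a_nonneg by simp
  then have S: "0 \<le> (\<Sum>n<N0. (t * a) ^ n)" by (intro sum_nonneg) simp
  have "t ^ n * p ((T ^^ n) x) \<le> C * p x" for n x
  proof (cases "n \<ge> N0")
    case True
    then show ?thesis
      using N0[OF True, of x] mult_right_mono[OF S p_nonneg[of x]] by (simp add: C_def algebra_simps)
  next
    case False
    have "t ^ n * p ((T ^^ n) x) \<le> t ^ n * (a ^ n * p x)"
      using assms by (intro mult_left_mono funpow_bound T_bound a_nonneg) auto
    also have "\<dots> = (t * a) ^ n * p x" by (simp add: power_mult_distrib)
    also have "\<dots> \<le> C * p x"
    proof (rule mult_right_mono[OF _ p_nonneg])
      have "(t * a) ^ n \<le> (\<Sum>n<N0. (t * a) ^ n)"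
        using False ta by (intro member_le_sum) auto
      then show "(t * a) ^ n \<le> C" by (simp add: C_def)
    qed
    finally show ?thesis .
  qed
  moreover have "C > 0" using S by (simp add: C_def)
  ultimately show ?thesis by blast
qed

end

section \<open>The topology in terms of the calibration\<close>

locale calibrated_space = vector_space scale
  for scale :: "complex \<Rightarrow> 'a \<Rightarrow> 'a::{topological_ab_group_add, t2_space}" (infixr "\<odot>" 75) +
  fixes P :: "('a \<Rightarrow> real) set"
  assumes calibration: "calibration scale P"
begin

lemma seminormed_space: "p \<in> P \<Longrightarrow> seminormed_space scale p"
  using calibration vector_space_axioms
  by (auto simp: calibration_def seminormed_space_def seminormed_space_axioms_def)

lemma seminorm_nhd:
  assumes "p \<in> P" "e > 0"
  obtains U where "open U" "0 \<in> U" "\<And>x. x \<in> U \<Longrightarrow> p x < e"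
proof -
  have "{x. p x < e} \<in> {{x. p x < e} | p e. p \<in> P \<and> e > 0}" using assms by blast
  then obtain U where "open U" "0 \<in> U" "U \<subseteq> {x. p x < e}"
    using calibration unfolding calibration_def Let_def by meson
  then show thesis using that by blast
qed

text \<open>Recodes the finite intersection of sub-basic sets by seminorm-radius pairs, so that
  thresholds can be chosen for each pair.\<close>

lemma finite_seminorm_nhds:
  assumes "open U" "0 \<in> U"
  obtains I where "finite I" "\<And>p e. (p, e) \<in> I \<Longrightarrow> p \<in> P \<and> e > 0"
    "\<And>x. (\<And>p e. (p, e) \<in> I \<Longrightarrow> p x < e) \<Longrightarrow> x \<in> U"
proof -
  let ?ball = "\<lambda>(p, e). {x. p x < (e::real)}"
  have "{{x. p x < e} | p e. p \<in> P \<and> e > 0} = ?ball ` (P \<times> {0<..})"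
    by force
  moreover obtain F where "finite F" "F \<subseteq> {{x. p x < e} | p e. p \<in> P \<and> e > 0}" "\<Inter>F \<subseteq> U"
    using calibration assms unfolding calibration_def Let_def by meson
  ultimately have F: "finite F" "F \<subseteq> ?ball ` (P \<times> {0<..})" "\<Inter>F \<subseteq> U" by simp_all
  obtain I where I: "finite I" "I \<subseteq> P \<times> {0<..}" "F = ?ball ` I"
    using finite_subset_image[OF F(1,2)] by blast
  show thesis
  proof
    show "x \<in> U" if "\<And>p e. (p, e) \<in> I \<Longrightarrow> p x < e" for x
      using that F(3) I(3) by fastforce
  qed (use I in auto)
qed

text \<open>A vector on which all seminorms vanish lies in every neighbourhood of 0, so the
  Hausdorff property makes it 0.\<close>

lemma seminorms_separate:
  assumes "\<And>p. p \<in> P \<Longrightarrow> p x = 0"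
  shows "x = 0"
proof (rule ccontr)
  assume "x \<noteq> 0"
  then obtain U where U: "open U" "0 \<in> U" "x \<notin> U" using t1_space by metis
  from finite_seminorm_nhds[OF U(1,2)] assms U(3) show False by metis
qed

lemma tendsto_seminorm:
  assumes "p \<in> P" "s \<longlonglongrightarrow> x"
  shows "(\<lambda>n. p (s n - x)) \<longlonglongrightarrow> 0"
proof (rule LIMSEQ_I)
  interpret seminormed_space scale p by (rule seminormed_space[OF assms(1)])
  fix e :: real assume "e > 0"
  then obtain U where U: "open U" "0 \<in> U" "\<And>x. x \<in> U \<Longrightarrow> p x < e"
    using seminorm_nhd[OF assms(1)] by blast
  have "(\<lambda>n. s n - x) \<longlonglongrightarrow> x - x" by (intro tendsto_intros assms)
  then have "\<forall>\<^sub>F n in sequentially. s n - x \<in> U"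
    using U by (auto dest: topological_tendstoD)
  then show "\<exists>N. \<forall>n\<ge>N. norm (p (s n - x) - 0) < e"
    using U(3) p_nonneg by (auto simp: eventually_sequentially)
qed

text \<open>Finitely many seminorm conditions suffice for membership in \<open>U\<close>, so their
  thresholds have a common upper bound.\<close>

lemma Cauchy_seq_seminorms:
  assumes "\<And>p e. p \<in> P \<Longrightarrow> e > 0 \<Longrightarrow> \<exists>N. \<forall>m\<ge>N. \<forall>n\<ge>N. p (s m - s n) < e"
  shows "Cauchy_seq s"
  unfolding Cauchy_seq_def
proof (intro allI impI)
  fix U :: "'a set" assume "open U \<and> 0 \<in> U"
  then obtain I where I: "finite I" "\<And>p e. (p, e) \<in> I \<Longrightarrow> p \<in> P \<and> e > 0"
    "\<And>x. (\<And>p e. (p, e) \<in> I \<Longrightarrow> p x < e) \<Longrightarrow> x \<in> U"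
    using finite_seminorm_nhds by metis
  obtain N where N: "\<And>p e m n. (p, e) \<in> I \<Longrightarrow> m \<ge> N p e \<Longrightarrow> n \<ge> N p e \<Longrightarrow> p (s m - s n) < e"
    using assms I(2) by metis
  obtain N0 where "\<forall>i\<in>I. case_prod N i \<le> N0"
    using finite_nat_set_iff_bounded_le[of "case_prod N ` I"] I(1) by auto
  then have N0: "(p, e) \<in> I \<Longrightarrow> N p e \<le> N0" for p e by fastforce
  have "s m - s n \<in> U" if "m \<ge> N0" "n \<ge> N0" for m n
    using N N0 that by (meson I(3) order_trans)
  then show "\<exists>N. \<forall>m\<ge>N. \<forall>n\<ge>N. s m - s n \<in> U" by blast
qed

section \<open>Closure properties of quotient bounded operators\<close>

lemma quotient_boundedI:
  assumes "Vector_Spaces.linear scale scale T"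
    and "\<And>p. p \<in> P \<Longrightarrow> \<exists>c. \<forall>x. p (T x) \<le> c * p x"
  shows "T \<in> quotient_bounded scale P"
proof -
  have "\<exists>c>0. \<forall>x. p (T x) \<le> c * p x" if p: "p \<in> P" for p
  proof -
    interpret seminormed_space scale p by (rule seminormed_space[OF p])
    obtain c where c: "\<And>x. p (T x) \<le> c * p x" using assms(2)[OF p] by blast
    have "p (T x) \<le> max c 1 * p x" for x
      by (rule order_trans[OF c]) (simp add: mult_right_mono p_nonneg)
    then show ?thesis by (intro exI[of _ "max c 1"]) auto
  qed
  with assms(1) show ?thesis by (simp add: quotient_bounded_def)
qed

lemma quotient_bounded_linear: "T \<in> quotient_bounded scale P \<Longrightarrow> Vector_Spaces.linear scale scale T"
  by (simp add: quotient_bounded_def)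

lemma quotient_bounded_bound:
  "T \<in> quotient_bounded scale P \<Longrightarrow> p \<in> P \<Longrightarrow> \<exists>c>0. \<forall>x. p (T x) \<le> c * p x"
  by (simp add: quotient_bounded_def)

lemma linear_smult:
  assumes "Vector_Spaces.linear scale scale T"
  shows "Vector_Spaces.linear scale scale (\<lambda>x. c \<odot> T x)"
  using assms unfolding Vector_Spaces.linear_iff by (simp add: scale_right_distrib mult.commute)

lemma quotient_bounded_smult:
  assumes "T \<in> quotient_bounded scale P"
  shows "(\<lambda>x. c \<odot> T x) \<in> quotient_bounded scale P"
proof (rule quotient_boundedI[OF linear_smult[OF quotient_bounded_linear[OF assms]]])
  fix p assume p: "p \<in> P"
  then interpret seminormed_space scale p by (rule seminormed_space)
  obtain b where "\<And>x. p (T x) \<le> b * p x" using quotient_bounded_bound[OF assms p] by blast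
  then have "p (c \<odot> T x) \<le> cmod c * b * p x" for x
    by (simp add: p_scale mult.assoc mult_left_mono)
  then show "\<exists>b. \<forall>x. p (c \<odot> T x) \<le> b * p x" by blast
qed

lemma quotient_bounded_funpow:
  assumes "T \<in> quotient_bounded scale P"
  shows "T ^^ n \<in> quotient_bounded scale P"
proof (rule quotient_boundedI)
  have T: "Vector_Spaces.linear scale scale T" by (rule quotient_bounded_linear[OF assms])
  show "Vector_Spaces.linear scale scale (T ^^ n)"
  proof (induction n)
    case 0
    then show ?case by (simp add: Vector_Spaces.linear_iff vector_space_axioms)
  next
    case (Suc n)
    then show ?case using T by (simp add: Vector_Spaces.linear_iff)
  qed
  fix p assume p: "p \<in> P"
  then interpret seminormed_space scale p by (rule seminormed_space)
  obtain a where "a > 0" "\<And>x. p (T x) \<le> a * p x" using quotient_bounded_bound[OF assms p] by blast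
  then show "\<exists>c. \<forall>x. p ((T ^^ n) x) \<le> c * p x" using funpow_bound[of T a n] by auto
qed

section \<open>Operator seminorms and bounded sets of operators\<close>

lemma op_seminorm_less_imp:
  assumes "p \<in> P" "S \<in> quotient_bounded scale P" "op_seminorm p S < e"
  shows "\<exists>c<e. 0 < c \<and> (\<forall>x. p (S x) \<le> c * p x)"
proof -
  have "{r. r > 0 \<and> (\<forall>x. p (S x) \<le> r * p x)} \<noteq> {}"
    using quotient_bounded_bound[OF assms(2,1)] by blast
  then show ?thesis
    using cInf_lessD[of "{r. r > 0 \<and> (\<forall>x. p (S x) \<le> r * p x)}" e] assms(3)
    unfolding op_seminorm_def by blast
qed

lemma op_seminorm_le:
  assumes "0 < c" "\<And>x. p (S x) \<le> c * p x"
  shows "op_seminorm p S \<le> c"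
  unfolding op_seminorm_def using assms
  by (intro cInf_lower bdd_belowI[of _ 0]) auto

lemma zero_quotient_bounded: "(\<lambda>x. 0) \<in> quotient_bounded scale P"
proof (rule quotient_boundedI)
  show "Vector_Spaces.linear scale scale (\<lambda>x. 0)"
    by (simp add: Vector_Spaces.linear_iff vector_space_axioms)
  fix p assume "p \<in> P"
  then interpret seminormed_space scale p by (rule seminormed_space)
  show "\<exists>c. \<forall>x. p 0 \<le> c * p x" by (intro exI[of _ 0]) (simp add: p_zero)
qed

text \<open>The open unit ball of the operator seminorm is a neighbourhood of the zero operator; the
  factor \<open>s\<close> by which it absorbs \<open>A\<close> serves as the uniform
  constant.\<close>

lemma qb_bounded_imp_seminorm_bounded:
  assumes A: "qb_bounded scale P A" and p: "p \<in> P"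
  shows "\<exists>C>0. \<forall>S\<in>A. \<forall>x. p (S x) \<le> C * p x"
proof -
  interpret seminormed_space scale p by (rule seminormed_space[OF p])
  \<comment> \<open>The subtraction of 0 matches the form of a sub-basic set centred at the zero
    operator.\<close>
  define U where "U = {S \<in> quotient_bounded scale P. op_seminorm p (\<lambda>x. S x - 0) < 1}"
  have "openin (qb_topology scale P) U"
    unfolding qb_topology_def
  proof (rule topology_generated_by_Basis, rule insertI2, rule CollectI)
    show "\<exists>q R e. U = {S \<in> quotient_bounded scale P. op_seminorm q (\<lambda>x. S x - R x) < e} \<and>
        q \<in> P \<and> R \<in> quotient_bounded scale P \<and> e > 0"
      using p zero_quotient_bounded
      by (intro exI[of _ p] exI[of _ "\<lambda>x. 0"] exI[of _ 1]) (simp add: U_def)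
  qed
  moreover have "(\<lambda>x. 0) \<in> U"
    using op_seminorm_le[of "1/2" p "\<lambda>x. 0 - 0"] p_nonneg zero_quotient_bounded
    by (simp add: U_def p_zero)
  ultimately obtain s where s: "s > 0" "\<And>c. cmod c \<ge> s \<Longrightarrow> A \<subseteq> (\<lambda>S x. c \<odot> S x) ` U"
    using A unfolding qb_bounded_def by meson
  have "p (S x) \<le> s * p x" if "S \<in> A" for S x
  proof -
    obtain V where V: "V \<in> U" "S = (\<lambda>x. of_real s \<odot> V x)"
      using s(2)[of "of_real s"] s(1) \<open>S \<in> A\<close> by auto
    obtain c where c: "c < 1" "\<And>x. p (V x) \<le> c * p x"
      using V(1) op_seminorm_less_imp[OF p, of V 1] by (auto simp: U_def)
    have "p (V x) \<le> 1 * p x"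
      by (rule order_trans[OF c(2)]) (intro mult_right_mono p_nonneg, use c in simp)
    then show ?thesis using s(1) by (simp add: V(2) p_scale)
  qed
  with s(1) show ?thesis by blast
qed

text \<open>Induction on the generation of \<open>U\<close> from the sub-base. Absorption is phrased
  as membership of \<open>inverse c \<odot> S\<close>, which passes directly to intersections and
  unions.\<close>

lemma seminorm_bounded_imp_absorbed:
  assumes A: "A \<subseteq> quotient_bounded scale P"
    and bound: "\<And>p. p \<in> P \<Longrightarrow> \<exists>C>0. \<forall>S\<in>A. \<forall>x. p (S x) \<le> C * p x"
    and "openin (qb_topology scale P) U" "(\<lambda>x. 0) \<in> U"
  shows "\<exists>s>0. \<forall>c. cmod c \<ge> s \<longrightarrow> (\<forall>S\<in>A. (\<lambda>x. inverse c \<odot> S x) \<in> U)"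
  using assms(3)[unfolded qb_topology_def, THEN openin_topology_generated_by] assms(4)
proof induction
  case (Int a b)
  then obtain s t where "s > 0" "\<forall>c. cmod c \<ge> s \<longrightarrow> (\<forall>S\<in>A. (\<lambda>x. inverse c \<odot> S x) \<in> a)"
    "t > 0" "\<forall>c. cmod c \<ge> t \<longrightarrow> (\<forall>S\<in>A. (\<lambda>x. inverse c \<odot> S x) \<in> b)"
    by blast
  then show ?case by (intro exI[of _ "max s t"]) auto
next
  case (UN K)
  then obtain k where "k \<in> K" "(\<lambda>x. 0) \<in> k" by blast
  with UN.IH[OF this] show ?case by blast
next
  case (Basis V)
  from Basis(1) consider "V = quotient_bounded scale P"
    | p R e where "V = {S \<in> quotient_bounded scale P. op_seminorm p (\<lambda>x. S x - R x) < e}"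
      "p \<in> P" "R \<in> quotient_bounded scale P" "e > 0"
    by blast
  then show ?case
  proof cases
    case 1
    then show ?thesis
      using A quotient_bounded_smult by (intro exI[of _ 1]) auto
  next
    case (2 p R e)
    interpret seminormed_space scale p by (rule seminormed_space[OF 2(2)])
    have "(\<lambda>x. 0 - R x) \<in> quotient_bounded scale P"
      using quotient_bounded_smult[OF 2(3), of "-1"] by (simp add: scale_minus_left)
    \<comment> \<open>The centre \<open>R\<close> need not be 0. That the zero operator lies in
      \<open>V\<close> bounds \<open>- R\<close> by some \<open>b < e\<close>, which leaves room for
      a small perturbation.\<close>
    then obtain b where b: "b < e" "0 < b" "\<And>x. p (0 - R x) \<le> b * p x"
      using op_seminorm_less_imp[OF 2(2), of "\<lambda>x. 0 - R x" e] Basis(2) 2(1) by blast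
    obtain C where C: "C > 0" "\<And>S x. S \<in> A \<Longrightarrow> p (S x) \<le> C * p x"
      using bound[OF 2(2)] by blast
    \<comment> \<open>Half of the gap: only \<open>d + b\<close> as a weak upper bound is obtained
      below, and it must stay strictly under \<open>e\<close>.\<close>
    define d where "d = (e - b) / 2"
    have d: "d > 0" "d + b < e" using b by (auto simp: d_def field_simps)
    have "(\<lambda>x. inverse c \<odot> S x) \<in> V" if c: "cmod c \<ge> C / d" and S: "S \<in> A" for c S
    proof -
      have c_pos: "cmod c > 0" using c C(1) d(1) by (meson divide_pos_pos less_le_trans)
      have "p (inverse c \<odot> S x - R x) \<le> (d + b) * p x" for x
      proof -
        have "p (inverse c \<odot> S x) \<le> inverse (cmod c) * (C * p x)"
          using C(2)[OF S] by (simp add: p_scale norm_inverse mult_left_mono)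
        also have "\<dots> = (C / cmod c) * p x" by (simp add: field_simps)
        also have "\<dots> \<le> d * p x"
        proof (rule mult_right_mono[OF _ p_nonneg])
          show "C / cmod c \<le> d" using c c_pos d(1) by (simp add: field_simps)
        qed
        finally show ?thesis
          using p_add[of "inverse c \<odot> S x" "0 - R x"] b(3)[of x] by (simp add: algebra_simps)
      qed
      then have "op_seminorm p (\<lambda>x. inverse c \<odot> S x - R x) \<le> d + b"
        using d b by (intro op_seminorm_le) auto
      then show ?thesis
        using d(2) A S quotient_bounded_smult by (auto simp: 2(1))
    qed
    then show ?thesis using C(1) d(1) by (intro exI[of _ "C / d"]) auto
  qed
qed simp

lemma qb_bounded_iff:
  "qb_bounded scale P A \<longleftrightarrow>
    A \<subseteq> quotient_bounded scale P \<and> (\<forall>p\<in>P. \<exists>C>0. \<forall>S\<in>A. \<forall>x. p (S x) \<le> C * p x)"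
proof (intro iffI conjI)
  assume A: "A \<subseteq> quotient_bounded scale P \<and> (\<forall>p\<in>P. \<exists>C>0. \<forall>S\<in>A. \<forall>x. p (S x) \<le> C * p x)"
  show "qb_bounded scale P A"
    unfolding qb_bounded_def
  proof (intro conjI allI impI)
    fix U assume U: "openin (qb_topology scale P) U \<and> (\<lambda>x. 0) \<in> U"
    obtain s where s: "s > 0" "\<And>c S. cmod c \<ge> s \<Longrightarrow> S \<in> A \<Longrightarrow> (\<lambda>x. inverse c \<odot> S x) \<in> U"
      using seminorm_bounded_imp_absorbed[of A U] A U by blast
    have "S \<in> (\<lambda>S x. c \<odot> S x) ` U" if "cmod c \<ge> s" "S \<in> A" for c S
    proof (rule image_eqI[OF _ s(2)[OF that]])
      have "c \<noteq> 0" using that(1) s(1) by auto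
      then show "S = (\<lambda>x. c \<odot> inverse c \<odot> S x)" by simp
    qed
    then show "\<exists>s>0. \<forall>c. cmod c \<ge> s \<longrightarrow> A \<subseteq> (\<lambda>S x. c \<odot> S x) ` U" using s(1) by blast
  qed (use A in blast)
qed (use qb_bounded_imp_seminorm_bounded in \<open>auto simp: qb_bounded_def\<close>)

section \<open>Bounded sets of scaled powers\<close>

lemma funpow_smult:
  assumes "Vector_Spaces.linear scale scale T"
  shows "((\<lambda>x. c \<odot> T x) ^^ n) x = c ^ n \<odot> (T ^^ n) x"
proof (induction n)
  case (Suc n)
  then show ?case using assms by (simp add: Vector_Spaces.linear_iff)
qed simp

text \<open>The powers in question are \<open>T^n\<close> divided by \<open>\<alpha>^n\<close>, so
  the seminorm criterion becomes a growth bound. The right-hand side also includes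
  \<open>n = 0\<close>, which is covered by enlarging the constant to at least 1.\<close>

lemma qb_bounded_powers_iff:
  assumes T: "T \<in> quotient_bounded scale P" and \<alpha>: "\<alpha> > 0"
  shows "qb_bounded scale P {(\<lambda>x. scale (of_real (inverse \<alpha>)) (T x)) ^^ n | n. n \<ge> 1} \<longleftrightarrow>
    (\<forall>p\<in>P. \<exists>C>0. \<forall>n x. p ((T ^^ n) x) \<le> C * \<alpha> ^ n * p x)" (is "?L \<longleftrightarrow> ?R")
proof -
  define S where "S n = (\<lambda>x. scale (of_real (inverse \<alpha>)) (T x)) ^^ n" for n
  have S_set: "{(\<lambda>x. scale (of_real (inverse \<alpha>)) (T x)) ^^ n | n. n \<ge> 1} = S ` {0<..}"
    by (auto simp: S_def)
  have S: "S n x = of_real (inverse \<alpha> ^ n) \<odot> (T ^^ n) x" for n x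
    by (simp only: S_def funpow_smult[OF quotient_bounded_linear[OF T]] of_real_power)
  have S_bounded: "S ` {0<..} \<subseteq> quotient_bounded scale P"
    using quotient_bounded_funpow[OF quotient_bounded_smult[OF T]] by (auto simp: S_def)
  have S_bound_iff: "p (S n x) \<le> C * p x \<longleftrightarrow> p ((T ^^ n) x) \<le> C * \<alpha> ^ n * p x"
    if "p \<in> P" for p n x C
  proof -
    interpret seminormed_space scale p by (rule seminormed_space[OF that])
    show ?thesis
      unfolding S p_scale norm_of_real using \<alpha> by (simp add: field_simps)
  qed
  have extend: "(\<exists>C>0. \<forall>n\<in>{0<..}. \<forall>x. p ((T ^^ n) x) \<le> C * \<alpha> ^ n * p x) \<longleftrightarrow>
      (\<exists>C>0. \<forall>n x. p ((T ^^ n) x) \<le> C * \<alpha> ^ n * p x)" if p: "p \<in> P" for p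
  proof
    interpret seminormed_space scale p by (rule seminormed_space[OF p])
    assume "\<exists>C>0. \<forall>n\<in>{0<..}. \<forall>x. p ((T ^^ n) x) \<le> C * \<alpha> ^ n * p x"
    then obtain C where C: "\<And>n x. n \<ge> 1 \<Longrightarrow> p ((T ^^ n) x) \<le> C * \<alpha> ^ n * p x"
      by (auto simp: Suc_le_eq)
    have "p ((T ^^ n) x) \<le> max C 1 * \<alpha> ^ n * p x" for n x
    proof (cases "n \<ge> 1")
      case True
      have "C * \<alpha> ^ n * p x \<le> max C 1 * \<alpha> ^ n * p x"
        using \<alpha> by (intro mult_right_mono p_nonneg) auto
      then show ?thesis using C[OF True] order_trans by blast
    next
      case False
      then have "n = 0" by simp
      then show ?thesis
        using mult_right_mono[of 1 "max C 1", OF _ p_nonneg[of x]] by simp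
    qed
    then show "\<exists>C>0. \<forall>n x. p ((T ^^ n) x) \<le> C * \<alpha> ^ n * p x"
      by (intro exI[of _ "max C 1"]) auto
  qed blast
  show ?thesis
    unfolding S_set qb_bounded_iff using S_bounded by (simp add: S_bound_iff extend cong: ball_cong)
qed

section \<open>Neumann series outside the radius of a power bound\<close>

lemma linear_resolvent:
  assumes T: "Vector_Spaces.linear scale scale T"
  shows "Vector_Spaces.linear scale scale (\<lambda>x. z \<odot> x - T x)"
  using T unfolding Vector_Spaces.linear_iff
  by (simp add: scale_right_distrib scale_right_diff_distrib mult.commute)

lemma linear_inv:
  assumes f: "Vector_Spaces.linear scale scale f" and "bij f"
  shows "Vector_Spaces.linear scale scale (inv f)"
proof -
  have inj: "f x = f y \<Longrightarrow> x = y" for x y using assms(2) by (meson bij_is_inj injD)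
  have f_inv: "f (inv f x) = x" for x using assms(2) by (simp add: bij_is_surj surj_f_inv_f)
  have f_add: "f (x + y) = f x + f y" and f_scale: "f (c \<odot> x) = c \<odot> f x" for x y c
    using f by (auto simp: Vector_Spaces.linear_iff)
  have "inv f (x + y) = inv f x + inv f y" for x y
    by (rule inj) (simp add: f_add f_inv)
  moreover have "inv f (c \<odot> x) = c \<odot> inv f x" for c x
    by (rule inj) (simp add: f_scale f_inv)
  ultimately show ?thesis by (simp add: Vector_Spaces.linear_iff vector_space_axioms)
qed


lemma funpow_eigenvector:
  assumes T: "Vector_Spaces.linear scale scale T" and "T x = z \<odot> x"
  shows "(T ^^ n) x = z ^ n \<odot> x"
  using assms by (induction n) (simp_all add: Vector_Spaces.linear_iff mult.commute)

text \<open>\<open>s N\<close> is a partial sum of the Neumann series for the resolvent at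
  \<open>z\<close>. Consecutive terms cancel, leaving only the error of order
  \<open>N\<close>.\<close>

lemma neumann_telescope:
  fixes y :: 'a
  assumes T: "Vector_Spaces.linear scale scale T" and z: "z \<noteq> 0"
  defines "s \<equiv> \<lambda>N. \<Sum>n<N. inverse (z ^ Suc n) \<odot> (T ^^ n) y"
  shows "z \<odot> s N - T (s N) = y - inverse (z ^ N) \<odot> (T ^^ N) y"
proof (induction N)
  case 0
  have "T 0 = 0" using T by (simp add: linear_iff_module_hom module_hom.zero)
  then show ?case by (simp add: s_def)
next
  case (Suc N)
  define u where "u = inverse (z ^ Suc N) \<odot> (T ^^ N) y"
  have "T u = inverse (z ^ Suc N) \<odot> (T ^^ Suc N) y" and add: "T (s N + u) = T (s N) + T u"
    using T by (simp_all add: u_def Vector_Spaces.linear_iff)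
  moreover have "z \<odot> u = inverse (z ^ N) \<odot> (T ^^ N) y"
    using z by (simp add: u_def)
  moreover have "s (Suc N) = s N + u" by (simp add: s_def u_def)
  ultimately show ?case using Suc by (simp add: scale_right_distrib algebra_simps)
qed

text \<open>The constant \<open>K\<close> is chosen so that the bound
  \<open>C * q^N / cmod z\<close> on the term of index \<open>N\<close> equals
  \<open>K * (q^N - q^(N+1))\<close>. The estimates then telescope.\<close>

lemma neumann_increment:
  fixes y :: 'a
  assumes p: "p \<in> P" and bound: "\<And>n x. p ((T ^^ n) x) \<le> C * \<alpha> ^ n * p x"
    and \<alpha>: "0 < \<alpha>" "\<alpha> < cmod z"
  defines "s \<equiv> \<lambda>N. \<Sum>n<N. inverse (z ^ Suc n) \<odot> (T ^^ n) y"
    and "q \<equiv> \<alpha> / cmod z" and "K \<equiv> C / (cmod z - \<alpha>)"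
  shows "p (s (n + k) - s n) \<le> K * (q ^ n - q ^ (n + k)) * p y"
proof (induction k)
  interpret seminormed_space scale p by (rule seminormed_space[OF p])
  case 0
  then show ?case by (simp add: p_zero)
next
  interpret seminormed_space scale p by (rule seminormed_space[OF p])
  case (Suc k)
  have z: "cmod z > 0" using \<alpha> by linarith
  define N where "N = n + k"
  define u where "u = inverse (z ^ Suc N) \<odot> (T ^^ N) y"
  have "p u = inverse (cmod z ^ Suc N) * p ((T ^^ N) y)"
    by (simp add: u_def p_scale norm_inverse norm_power norm_mult)
  also have "\<dots> \<le> inverse (cmod z ^ Suc N) * (C * \<alpha> ^ N * p y)"
    by (intro mult_left_mono bound) simp
  also have "\<dots> = K * (q ^ N - q ^ Suc N) * p y"
  proof -
    have "q ^ N - q ^ Suc N = q ^ N * ((cmod z - \<alpha>) / cmod z)"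
      using z by (simp add: q_def field_simps)
    then have "K * (q ^ N - q ^ Suc N) = C * q ^ N / cmod z"
      using \<alpha> by (simp add: K_def)
    moreover have "inverse (cmod z ^ Suc N) * (C * \<alpha> ^ N * p y) = C * q ^ N / cmod z * p y"
      using z by (simp add: q_def power_divide field_simps)
    ultimately show ?thesis by simp
  qed
  finally have "p u \<le> K * (q ^ N - q ^ Suc N) * p y" .
  moreover have "s (n + Suc k) - s n = (s N - s n) + u"
    by (simp add: s_def u_def N_def)
  ultimately show ?case
    using Suc p_add[of "s N - s n" u] by (simp add: N_def algebra_simps)
qed

text \<open>Sequential completeness yields a limit of the Neumann partial sums; the bound and the
  equation are then checked one seminorm at a time. The constant is independent of \<open>y\<close>,
  so it will bound the inverse operator.\<close>

lemma resolvent_equation_solution: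
  assumes complete: "sequentially_complete TYPE('a)"
    and T: "T \<in> quotient_bounded scale P"
    and \<alpha>: "0 < \<alpha>" "\<alpha> < cmod z"
    and C: "\<And>p. p \<in> P \<Longrightarrow> C p > 0"
    and bound: "\<And>p n x. p \<in> P \<Longrightarrow> p ((T ^^ n) x) \<le> C p * \<alpha> ^ n * p x"
  shows "\<exists>x. z \<odot> x - T x = y \<and> (\<forall>p\<in>P. p x \<le> C p / (cmod z - \<alpha>) * p y)"
proof -
  define s where "s = (\<lambda>N. \<Sum>n<N. inverse (z ^ Suc n) \<odot> (T ^^ n) y)"
  define q where "q = \<alpha> / cmod z"
  define K where "K p = C p / (cmod z - \<alpha>)" for p
  have z_pos: "cmod z > 0" using \<alpha> by linarith
  then have q: "0 < q" "q < 1" using \<alpha> by (simp_all add: q_def)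
  have K: "p \<in> P \<Longrightarrow> K p > 0" for p using C[of p] \<alpha> by (simp add: K_def)
  have z: "z \<noteq> 0" using \<alpha> by auto
  have increment: "p (s m - s n) \<le> K p * q ^ n * p y" if p: "p \<in> P" and "n \<le> m" for p m n
  proof -
    interpret seminormed_space scale p by (rule seminormed_space[OF p])
    have "p (s m - s n) \<le> K p * (q ^ n - q ^ m) * p y"
      using neumann_increment[OF p bound[OF p] \<alpha>, of y n "m - n"] \<open>n \<le> m\<close>
      by (simp add: s_def K_def q_def)
    also have "\<dots> \<le> K p * q ^ n * p y"
      using K[OF p] q by (intro mult_right_mono mult_left_mono p_nonneg) auto
    finally show ?thesis .
  qed
  have decay: "(\<lambda>n. c * q ^ n * d) \<longlonglongrightarrow> 0" for c d
    using q by (auto intro!: tendsto_eq_intros LIMSEQ_realpow_zero)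
  have "Cauchy_seq s"
  proof (rule Cauchy_seq_seminorms)
    fix p and e :: real assume p: "p \<in> P" and e: "e > 0"
    interpret seminormed_space scale p by (rule seminormed_space[OF p])
    obtain N where N: "\<And>n. n \<ge> N \<Longrightarrow> K p * q ^ n * p y < e"
      using order_tendstoD(2)[OF decay e] unfolding eventually_sequentially by blast
    have "p (s m - s n) < e" if "m \<ge> N" "n \<ge> N" for m n
    proof (cases "n \<le> m")
      case True
      then show ?thesis using increment[OF p True] N[OF that(2)] by simp
    next
      case False
      then have "p (s n - s m) < e" using increment[OF p, of m n] N[OF that(1)] by simp
      then show ?thesis using p_minus[of "s n - s m"] by simp
    qed
    then show "\<exists>N. \<forall>m\<ge>N. \<forall>n\<ge>N. p (s m - s n) < e" by blast
  qed
  then obtain x where x: "s \<longlonglongrightarrow> x"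
    using complete unfolding sequentially_complete_def convergent_def by blast
  have "p x \<le> K p * p y" if p: "p \<in> P" for p
  proof -
    interpret seminormed_space scale p by (rule seminormed_space[OF p])
    have lim: "(\<lambda>n. K p * p y + p (s n - x)) \<longlonglongrightarrow> K p * p y + 0"
      by (intro tendsto_intros tendsto_seminorm[OF p x])
    \<comment> \<open>Since \<open>s 0 = 0\<close>, the increment estimate from index 0 bounds
      \<open>p (s n)\<close> itself.\<close>
    have "p x \<le> K p * p y + p (s n - x)" for n
      using increment[OF p, of 0 n] p_diff[of "s n" "s n - x"] by (simp add: s_def)
    then show ?thesis using LIMSEQ_le_const[OF lim] by simp
  qed
  moreover have "z \<odot> x - T x = y"
  proof -
    have "z \<odot> x - T x - y = 0"
    proof (rule seminorms_separate)
      fix p assume p: "p \<in> P"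
      then interpret seminormed_space scale p by (rule seminormed_space)
      obtain a where a: "a > 0" "\<And>x. p (T x) \<le> a * p x" using quotient_bounded_bound[OF T p] by blast
      have lim: "(\<lambda>n. (cmod z + a) * p (s n - x) + C p * q ^ n * p y) \<longlonglongrightarrow> (cmod z + a) * 0 + 0"
        by (intro tendsto_intros tendsto_seminorm[OF p x] decay)
      have "p (z \<odot> x - T x - y) \<le> (cmod z + a) * p (s n - x) + C p * q ^ n * p y" for n
      proof -
        define d where "d = s n - x"
        define u where "u = inverse (z ^ n) \<odot> (T ^^ n) y"
        have Td: "T d = T (s n) - T x"
          using quotient_bounded_linear[OF T]
          by (simp add: d_def linear_iff_module_hom module_hom.diff)
        have "z \<odot> s n - T (s n) = y - u"
          using neumann_telescope[OF quotient_bounded_linear[OF T] z] by (simp add: s_def u_def)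
        \<comment> \<open>Substituting \<open>x = s n - d\<close> splits the residual into the
          effect of the distance to the limit and the Neumann error; both tend to 0.\<close>
        then have "z \<odot> x - T x - y = - ((z \<odot> d - T d) + u)"
          unfolding Td by (simp add: d_def scale_right_diff_distrib algebra_simps)
        then have "p (z \<odot> x - T x - y) \<le> p (z \<odot> d - T d) + p u"
          using p_add p_minus by metis
        moreover have "p (z \<odot> d - T d) \<le> (cmod z + a) * p d"
          using p_diff[of "z \<odot> d" "T d"] a(2)[of d] by (simp add: p_scale algebra_simps)
        moreover have "p u \<le> C p * q ^ n * p y"
        proof -
          have "p u = inverse (cmod z ^ n) * p ((T ^^ n) y)"
            by (simp add: u_def p_scale norm_inverse norm_power)
          also have "\<dots> \<le> inverse (cmod z ^ n) * (C p * \<alpha> ^ n * p y)"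
            by (intro mult_left_mono bound p) simp
          finally show ?thesis by (simp add: q_def power_divide field_simps)
        qed
        ultimately show ?thesis by (simp add: d_def)
      qed
      then have "p (z \<odot> x - T x - y) \<le> 0" using LIMSEQ_le_const[OF lim] by simp
      then show "p (z \<odot> x - T x - y) = 0" using p_nonneg by (simp add: antisym)
    qed
    then show ?thesis by simp
  qed
  ultimately show ?thesis unfolding K_def by blast
qed

text \<open>A kernel vector \<open>d\<close> is an eigenvector for \<open>z\<close>, so its orbit
  grows like \<open>cmod z ^ n\<close>. The slower growth bound with \<open>\<alpha>\<close> forces
  every seminorm of \<open>d\<close> to vanish.\<close>

lemma inj_resolvent:
  assumes T: "T \<in> quotient_bounded scale P"
    and \<alpha>: "0 < \<alpha>" "\<alpha> < cmod z"
    and bound: "\<And>p. p \<in> P \<Longrightarrow> \<exists>C>0. \<forall>n x. p ((T ^^ n) x) \<le> C * \<alpha> ^ n * p x"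
  shows "inj (\<lambda>x. z \<odot> x - T x)"
proof (rule injI)
  fix x x' assume eq: "z \<odot> x - T x = z \<odot> x' - T x'"
  have lin: "Vector_Spaces.linear scale scale T" by (rule quotient_bounded_linear[OF T])
  define d where "d = x - x'"
  have "T d = z \<odot> d"
    using eq lin by (simp add: d_def linear_iff_module_hom module_hom.diff scale_right_diff_distrib algebra_simps)
  then have pow: "(T ^^ n) d = z ^ n \<odot> d" for n by (rule funpow_eigenvector[OF lin])
  have "d = 0"
  proof (rule seminorms_separate)
    fix p assume p: "p \<in> P"
    then interpret seminormed_space scale p by (rule seminormed_space)
    obtain C where C: "C > 0" "\<And>n x. p ((T ^^ n) x) \<le> C * \<alpha> ^ n * p x" using bound[OF p] by blast
    have z_pos: "cmod z > 0" using \<alpha> by linarith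
    have "p d \<le> C * (\<alpha> / cmod z) ^ n * p d" for n
    proof -
      have "cmod z ^ n * p d \<le> C * \<alpha> ^ n * p d"
        using C(2)[of n d] by (simp add: pow p_scale norm_power)
      then show ?thesis using z_pos by (simp add: power_divide field_simps)
    qed
    moreover have "(\<lambda>n. C * (\<alpha> / cmod z) ^ n * p d) \<longlonglongrightarrow> 0"
      using \<alpha> z_pos by (auto intro!: tendsto_eq_intros LIMSEQ_realpow_zero)
    ultimately have "p d \<le> 0" using LIMSEQ_le_const by blast
    then show "p d = 0" using p_nonneg by (simp add: antisym)
  qed
  then show "x = x'" by (simp add: d_def)
qed

text \<open>The Neumann series gives surjectivity. By injectivity its sum is the value of the
  inverse, which therefore inherits the seminorm bounds.\<close>

lemma resolvent_set_outside_power_bound: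
  assumes complete: "sequentially_complete TYPE('a)"
    and T: "T \<in> quotient_bounded scale P"
    and \<alpha>: "0 < \<alpha>" "\<alpha> < cmod z"
    and bound: "\<And>p. p \<in> P \<Longrightarrow> \<exists>C>0. \<forall>n x. p ((T ^^ n) x) \<le> C * \<alpha> ^ n * p x"
  shows "z \<in> resolvent_set_P scale P T"
proof -
  define f where "f = (\<lambda>x. z \<odot> x - T x)"
  obtain C where C: "\<And>p. p \<in> P \<Longrightarrow> C p > 0"
    "\<And>p n x. p \<in> P \<Longrightarrow> p ((T ^^ n) x) \<le> C p * \<alpha> ^ n * p x"
    using bound by metis
  have sol: "\<exists>x. f x = y \<and> (\<forall>p\<in>P. p x \<le> C p / (cmod z - \<alpha>) * p y)" for y
    using resolvent_equation_solution[OF complete T \<alpha> C] by (simp add: f_def)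
  have inj: "inj f" unfolding f_def by (rule inj_resolvent[OF T \<alpha> bound])
  moreover have "surj f" using sol by (metis surjI)
  ultimately have "bij f" by (simp add: bij_def)
  moreover have "inv f \<in> quotient_bounded scale P"
  proof (rule quotient_boundedI)
    show "Vector_Spaces.linear scale scale (inv f)"
      using \<open>bij f\<close> linear_resolvent[OF quotient_bounded_linear[OF T]]
      by (intro linear_inv) (simp_all add: f_def)
    fix p assume "p \<in> P"
    then have "p (inv f y) \<le> C p / (cmod z - \<alpha>) * p y" for y
      using sol[of y] inv_f_f[OF inj] by auto
    then show "\<exists>c. \<forall>y. p (inv f y) \<le> c * p y" by blast
  qed
  ultimately show ?thesis by (simp add: resolvent_set_P_def f_def)
qed

section \<open>Power bounds from the resolvent outside a disc\<close>

lemma power_bound_outside_spectrum: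
  assumes T: "T \<in> quotient_bounded scale P"
    and \<beta>: "0 < \<beta>" "\<beta> < \<alpha>"
    and res: "\<And>z. cmod z \<ge> \<beta> \<Longrightarrow> z \<in> resolvent_set_P scale P T"
    and p: "p \<in> P"
  shows "\<exists>C>0. \<forall>n x. p ((T ^^ n) x) \<le> C * \<alpha> ^ n * p x"
proof -
  interpret seminormed_space scale p by (rule seminormed_space[OF p])
  define f where "f w = (\<lambda>x. inverse w \<odot> x - T x)" for w
  \<comment> \<open>For \<open>w \<noteq> 0\<close>, inverting
    \<open>1 - w T = w (inverse w - T)\<close> gives this formula. The point \<open>w = 0\<close>,
    where the inverse is the identity, corresponds to infinity and is set separately.\<close>
  define R where "R w = (if w = 0 then id else (\<lambda>x. inv (f w) (inverse w \<odot> x)))" for w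
  obtain a where a: "a > 0" "\<And>x. p (T x) \<le> a * p x" using quotient_bounded_bound[OF T p] by blast
  have f: "bij (f w)" "inv (f w) \<in> quotient_bounded scale P" if "w \<noteq> 0" "cmod w \<le> 1 / \<beta>" for w
  proof -
    have "\<beta> \<le> cmod (inverse w)"
      using that \<beta>(1) by (simp add: norm_inverse norm_divide field_simps)
    from res[OF this] show "bij (f w)" "inv (f w) \<in> quotient_bounded scale P"
      by (simp_all add: resolvent_set_P_def f_def)
  qed
  have f_scaled: "w \<odot> f w x = x - w \<odot> T x" if "w \<noteq> 0" for w x
    using that by (simp add: f_def scale_right_diff_distrib)
  interpret resolvent_on_disc scale p T R "1 / \<beta>" a
  proof (intro resolvent_on_disc.intro resolvent_on_disc_axioms.intro)
    show "seminormed_space scale p" by (rule seminormed_space[OF p])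
    show "Vector_Spaces.linear scale scale T" by (rule quotient_bounded_linear[OF T])
    show "p (T x) \<le> a * p x" for x by (rule a)
    show "0 \<le> a" using a by simp
  next
    fix w :: complex assume w: "cmod w \<le> 1 / \<beta>"
    show "Vector_Spaces.linear scale scale (R w)"
    proof (cases "w = 0")
      case True
      then show ?thesis by (simp add: R_def Vector_Spaces.linear_iff vector_space_axioms)
    next
      case False
      then show ?thesis
        using quotient_bounded_linear[OF f(2)[OF False w]]
        by (simp add: R_def Vector_Spaces.linear_iff scale_right_distrib mult.commute)
    qed
    show "R w (x - w \<odot> T x) = x" for x
    proof (cases "w = 0")
      case False
      have "inverse w \<odot> (x - w \<odot> T x) = f w x"
        using False by (simp add: f_def scale_right_diff_distrib)
      then show ?thesis
        using False f(1)[OF False w] by (simp add: R_def bij_is_inj)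
    qed (simp add: R_def)
    show "R w x - w \<odot> T (R w x) = x" for x
    proof (cases "w = 0")
      case False
      have "f w (R w x) = inverse w \<odot> x"
        using False f(1)[OF False w] by (simp add: R_def bij_is_surj surj_f_inv_f)
      then show ?thesis
        using False f_scaled[OF False, of "R w x"] by simp
    qed (simp add: R_def)
    show "\<exists>c. \<forall>x. p (R w x) \<le> c * p x"
    proof (cases "w = 0")
      case True
      then show ?thesis by (intro exI[of _ 1]) (simp add: R_def)
    next
      case False
      obtain c where c: "\<And>x. p (inv (f w) x) \<le> c * p x"
        using quotient_bounded_bound[OF f(2)[OF False w] p] by blast
      have "p (R w x) \<le> c * inverse (cmod w) * p x" for x
        using c[of "inverse w \<odot> x"] False
        by (simp add: R_def p_scale norm_inverse mult.assoc)
      then show "\<exists>c. \<forall>x. p (R w x) \<le> c * p x" by blast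
    qed
  qed
  \<comment> \<open>The reciprocal of \<open>\<alpha>\<close> lies strictly inside the disc of
    radius \<open>1 / \<beta>\<close>, as the growth estimate demands.\<close>
  have "0 \<le> 1 / \<alpha>" "1 / \<alpha> < 1 / \<beta>" using \<beta> by (auto simp: field_simps)
  then obtain C where C: "C > 0" "\<And>n x. (1 / \<alpha>) ^ n * p ((T ^^ n) x) \<le> C * p x"
    using powers_bounded_below by blast
  have "p ((T ^^ n) x) \<le> C * \<alpha> ^ n * p x" for n x
    using C(2)[of n x] \<beta> by (simp add: power_divide field_simps)
  with C(1) show ?thesis by blast
qed

section \<open>The two inequalities between spectrum and spectral radius\<close>

lemma spectrum_modulus_eq_spectral_radius:
  assumes complete: "sequentially_complete TYPE('a)"
    and T: "T \<in> quotient_bounded scale P"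
  shows "set_modulus (spectrum_P scale P T) = spectral_radius_P scale P T"
proof (rule antisym)
  show "set_modulus (spectrum_P scale P T) \<le> spectral_radius_P scale P T"
    unfolding set_modulus_def spectral_radius_P_def
  proof (intro SUP_least INF_greatest)
    fix z \<alpha>
    assume z: "z \<in> spectrum_P scale P T"
      and \<alpha>: "\<alpha> \<in> {\<alpha>. \<alpha> > 0 \<and>
        qb_bounded scale P {(\<lambda>x. scale (of_real (inverse \<alpha>)) (T x)) ^^ n | n. n \<ge> 1}}"
    have pos: "\<alpha> > 0" using \<alpha> by simp
    have "\<forall>p\<in>P. \<exists>C>0. \<forall>n x. p ((T ^^ n) x) \<le> C * \<alpha> ^ n * p x"
      using \<alpha> qb_bounded_powers_iff[OF T pos] by simp
    then have "\<not> \<alpha> < cmod z"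
      using resolvent_set_outside_power_bound[OF complete T pos, of z] z
      by (auto simp: spectrum_P_def)
    then show "ennreal (cmod z) \<le> ennreal \<alpha>" by (simp add: ennreal_leI)
  qed
next
  show "spectral_radius_P scale P T \<le> set_modulus (spectrum_P scale P T)"
  \<comment> \<open>This rule leaves only the case of a finite spectral modulus and allows an error
    \<open>e\<close>.\<close>
  proof (rule ennreal_le_epsilon)
    fix e :: real
    assume fin: "set_modulus (spectrum_P scale P T) < top" and e: "e > 0"
    define b where "b = enn2real (set_modulus (spectrum_P scale P T))"
    have b: "b \<ge> 0" "set_modulus (spectrum_P scale P T) = ennreal b"
      using fin by (simp_all add: b_def)
    have res: "z \<in> resolvent_set_P scale P T" if "cmod z \<ge> b + e / 2" for z
    proof (rule ccontr)
      assume "z \<notin> resolvent_set_P scale P T"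
      then have "ennreal (cmod z) \<le> ennreal b"
        unfolding b(2)[symmetric] set_modulus_def by (intro SUP_upper) (simp add: spectrum_P_def)
      then have "cmod z \<le> b" using b(1) by simp
      then show False using that e by simp
    qed
    \<comment> \<open>The first half of \<open>e\<close> moves outside the spectrum and makes the
      radius positive even if \<open>b = 0\<close>; the second half gives the strict gap needed for
      the power bound.\<close>
    have pos: "0 < b + e / 2" "b + e / 2 < b + e" "0 < b + e" using b(1) e by auto
    have "qb_bounded scale P {(\<lambda>x. scale (of_real (inverse (b + e))) (T x)) ^^ n | n. n \<ge> 1}"
      unfolding qb_bounded_powers_iff[OF T pos(3)]
      using power_bound_outside_spectrum[OF T pos(1,2) res] by blast
    then have "spectral_radius_P scale P T \<le> ennreal (b + e)"
      unfolding spectral_radius_P_def using pos(3) by (intro INF_lower) simp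
    also have "\<dots> = set_modulus (spectrum_P scale P T) + ennreal e"
      using b e by simp
    finally show "spectral_radius_P scale P T \<le> set_modulus (spectrum_P scale P T) + ennreal e" .
  qed
qed

end

theorem proposition2p13:
  fixes scaleC :: "complex \<Rightarrow> 'a \<Rightarrow> 'a::{topological_ab_group_add, t2_space}"
    and P :: "('a \<Rightarrow> real) set"
    and T :: "'a \<Rightarrow> 'a"
  assumes "locally_convex_space scaleC"
    and "sequentially_complete TYPE('a)"
    and "calibration scaleC P"
    and "T \<in> quotient_bounded scaleC P"
  shows "set_modulus (spectrum_P scaleC P T) = spectral_radius_P scaleC P T"
proof -
  interpret calibrated_space scaleC P
    using assms(1,3)
    by (simp add: calibrated_space_def calibrated_space_axioms_def locally_convex_space_def)
  show ?thesis by (rule spectrum_modulus_eq_spectral_radius[OF assms(2,4)])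
qed

end
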